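(* There exist a complex Hilbert space $H$ and a densely defined, unbounded, closed linear operator $T$ on $H$, with domain $D(T)\subset H$, such that $$D(T^2)=D\big((T^* )^2\big)=\{0\}.$$
   Context: An operator on a Hilbert space $H$ is a linear map $T:D(T)\to H$ defined on a linear subspace $D(T)\subset H$ (its domain). "Unbounded" means not bounded on its domain. $T^*$ denotes the Hilbert-space adjoint of the densely defined operator $T$. For operators $S,R$ on $H$, the product $SR$ has domain $D(SR)=\{x\in D(R): Rx\in D(S)\}$; in particular $D(T^2)=\{x\in D(T): Tx\in D(T)\}$ and $D((T^* )^2)=\{x\in D(T^* ): T^*x\in D(T^* )\}$. *)

theory Defs
  imports "HOL-Analysis.Analysis" "HOL-Algebra.Module" "HOL-Algebra.Algebraic_Closure_Type"
begin

text \<open>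
  Complex inner product spaces are modules over the complex numbers (in the carrier-based sense of
  \<open>HOL-Algebra\<close>) with an inner product that is linear in the first argument. As for every
  \<open>module\<close>, the fields \<open>mult\<close> and \<open>one\<close> of the record are irrelevant.
\<close>

abbreviation complex_field :: "complex ring" where
  "complex_field \<equiv> ring_of_type_algebra"

record 'a inner_module = "(complex, 'a) module" +
  ip :: "'a \<Rightarrow> 'a \<Rightarrow> complex"

definition hnorm :: "('a, 'm) inner_module_scheme \<Rightarrow> 'a \<Rightarrow> real" where
  "hnorm H x = sqrt (Re (ip H x x))"

text \<open>The value off the carrier only serves \<^locale>\<open>Metric_space\<close>, which demands symmetry
  and nonnegativity of the distance on the whole type.\<close>

definition hdist :: "('a, 'm) inner_module_scheme \<Rightarrow> 'a \<Rightarrow> 'a \<Rightarrow> real" where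
  "hdist H x y = (if x \<in> carrier H \<and> y \<in> carrier H then hnorm H (x \<ominus>\<^bsub>H\<^esub> y) else 0)"

locale complex_inner_space = module complex_field H
  for H :: "('a, 'm) inner_module_scheme" (structure) +
  assumes ip_add_left: "\<lbrakk>x \<in> carrier H; y \<in> carrier H; z \<in> carrier H\<rbrakk>
      \<Longrightarrow> ip H (x \<oplus> y) z = ip H x z + ip H y z"
    and ip_smult_left: "\<lbrakk>x \<in> carrier H; y \<in> carrier H\<rbrakk>
      \<Longrightarrow> ip H (a \<odot> x) y = a * ip H x y"
    and ip_commute: "\<lbrakk>x \<in> carrier H; y \<in> carrier H\<rbrakk> \<Longrightarrow> ip H x y = cnj (ip H y x)"
    and ip_pos: "\<lbrakk>x \<in> carrier H; x \<noteq> \<zero>\<rbrakk> \<Longrightarrow> 0 < Re (ip H x x)"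
begin

lemma carrier_complex_field [simp]: "a \<in> carrier complex_field"
  by (simp add: ring_of_type_algebra_def)

lemma ip_add_right: "\<lbrakk>x \<in> carrier H; y \<in> carrier H; z \<in> carrier H\<rbrakk>
    \<Longrightarrow> ip H z (x \<oplus> y) = ip H z x + ip H z y"
  by (metis M.add.m_closed complex_cnj_add ip_add_left ip_commute)

lemma ip_smult_right: "\<lbrakk>x \<in> carrier H; y \<in> carrier H\<rbrakk> \<Longrightarrow> ip H y (a \<odot> x) = cnj a * ip H y x"
  by (metis carrier_complex_field complex_cnj_mult ip_commute ip_smult_left smult_closed)

lemma ip_zero_zero: "ip H \<zero> \<zero> = 0"
  using ip_add_left[of \<zero> \<zero> \<zero>] by simp

lemma ip_nonneg: "x \<in> carrier H \<Longrightarrow> 0 \<le> Re (ip H x x)"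
  using ip_pos[of x] ip_zero_zero by (cases "x = \<zero>") auto

lemma hnorm_nonneg: "x \<in> carrier H \<Longrightarrow> 0 \<le> hnorm H x"
  by (simp add: hnorm_def ip_nonneg)

lemma hnorm_power2: "x \<in> carrier H \<Longrightarrow> (hnorm H x)\<^sup>2 = Re (ip H x x)"
  by (simp add: hnorm_def ip_nonneg)

lemma hnorm_eq_0: "x \<in> carrier H \<Longrightarrow> hnorm H x = 0 \<longleftrightarrow> x = \<zero>"
  using ip_pos[of x] ip_zero_zero by (fastforce simp: hnorm_def)

lemma hnorm_smult:
  assumes "x \<in> carrier H"
  shows "hnorm H (a \<odot> x) = cmod a * hnorm H x"
proof -
  have "ip H (a \<odot> x) (a \<odot> x) = (a * cnj a) * ip H x x"
    using assms by (simp add: ip_smult_left ip_smult_right)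
  also have "\<dots> = of_real ((cmod a)\<^sup>2) * ip H x x"
    by (simp flip: complex_norm_square)
  finally have "Re (ip H (a \<odot> x) (a \<odot> x)) = (cmod a)\<^sup>2 * Re (ip H x x)"
    by simp
  then show ?thesis
    by (simp add: hnorm_def real_sqrt_mult)
qed

lemma Re_ip_le:
  assumes u: "u \<in> carrier H" and v: "v \<in> carrier H"
  shows "Re (ip H u v) \<le> hnorm H u * hnorm H v"
proof (cases "v = \<zero>")
  case True
  have "ip H u \<zero> = 0"
    using ip_add_right[of \<zero> \<zero> u] u by simp
  then show ?thesis
    using True by (simp add: hnorm_def ip_zero_zero)
next
  case False
  define b where "b = Re (ip H u v)"
  define n where "n = Re (ip H v v)"
  define t where "t = - b / n"
  define w where "w = complex_of_real t \<odot> v"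
  have n: "n > 0"
    using ip_pos[OF v False] by (simp add: n_def)
  have w: "w \<in> carrier H"
    using v by (simp add: w_def)
  have "Re (ip H v u) = b"
    using ip_commute[OF u v] by (simp add: b_def)
  then have "Re (ip H (u \<oplus> w) (u \<oplus> w)) = Re (ip H u u) + 2 * t * b + t\<^sup>2 * n"
    using u v w
    by (simp add: ip_add_left ip_add_right)
       (simp add: w_def ip_smult_left ip_smult_right b_def n_def power2_eq_square)
  moreover have "0 \<le> Re (ip H (u \<oplus> w) (u \<oplus> w))"
    using u w by (simp add: ip_nonneg)
  moreover have "2 * t * b + t\<^sup>2 * n = - (b\<^sup>2 / n)"
    using n by (simp add: t_def power2_eq_square field_simps)
  ultimately have "b\<^sup>2 / n \<le> Re (ip H u u)"
    by simp
  then have "b\<^sup>2 \<le> Re (ip H u u) * n"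
    using n by (simp add: field_simps)
  then have "b\<^sup>2 \<le> (hnorm H u * hnorm H v)\<^sup>2"
    using u v by (simp add: power_mult_distrib hnorm_power2 n_def)
  then show ?thesis
    unfolding b_def[symmetric]
    by (rule power2_le_imp_le) (use u v in \<open>simp add: hnorm_nonneg\<close>)
qed

lemma hnorm_triangle:
  assumes u: "u \<in> carrier H" and v: "v \<in> carrier H"
  shows "hnorm H (u \<oplus> v) \<le> hnorm H u + hnorm H v"
proof (rule power2_le_imp_le)
  have "Re (ip H v u) = Re (ip H u v)"
    using ip_commute[OF u v] by simp
  then have "(hnorm H (u \<oplus> v))\<^sup>2 = (hnorm H u)\<^sup>2 + (hnorm H v)\<^sup>2 + 2 * Re (ip H u v)"
    using u v by (simp add: hnorm_power2 ip_add_left ip_add_right)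
  also have "\<dots> \<le> (hnorm H u + hnorm H v)\<^sup>2"
    using Re_ip_le[OF u v] by (simp add: power2_sum)
  finally show "(hnorm H (u \<oplus> v))\<^sup>2 \<le> (hnorm H u + hnorm H v)\<^sup>2" .
  show "0 \<le> hnorm H u + hnorm H v"
    using u v by (simp add: hnorm_nonneg)
qed

lemma Metric_space_hdist: "Metric_space (carrier H) (hdist H)"
proof
  fix x y
  show "0 \<le> hdist H x y"
    by (simp add: hdist_def hnorm_nonneg)
  show "hdist H x y = hdist H y x"
  proof (cases "x \<in> carrier H \<and> y \<in> carrier H")
    case True
    have "ip H (\<ominus> z) (\<ominus> z) = ip H z z" if z: "z \<in> carrier H" for z
    proof -
      have 0: "ip H \<zero> w = 0" if "w \<in> carrier H" for w
        using ip_add_left[of \<zero> \<zero> w] that by simp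
      have *: "ip H (\<ominus> z) w = - ip H z w" if "w \<in> carrier H" for w
        using ip_add_left[of z "\<ominus> z" w] 0[OF that] z that
        by (simp add: M.r_neg eq_neg_iff_add_eq_0 add.commute)
      have "ip H z (\<ominus> z) = - ip H z z"
        using ip_commute[of z "\<ominus> z"] *[of z] ip_commute[of z z] z by simp
      then show ?thesis
        using *[of "\<ominus> z"] z by simp
    qed
    moreover have "y \<ominus> x = \<ominus> (x \<ominus> y)"
      using True by (simp add: M.minus_eq M.minus_add M.a_comm)
    ultimately show ?thesis
      using True by (simp add: hdist_def hnorm_def)
  qed (auto simp: hdist_def)
next
  fix x y
  assume "x \<in> carrier H" "y \<in> carrier H"
  then show "hdist H x y = 0 \<longleftrightarrow> x = y"
    by (simp add: hdist_def hnorm_eq_0 M.minus_eq M.minus_equality)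
       (metis M.a_inv_closed M.minus_equality M.minus_minus M.r_neg)
next
  fix x y z
  assume xyz: "x \<in> carrier H" "y \<in> carrier H" "z \<in> carrier H"
  have "(x \<ominus> y) \<oplus> (y \<ominus> z) = x \<oplus> (\<ominus> y \<oplus> y) \<oplus> \<ominus> z"
    using xyz by (simp add: M.minus_eq M.a_assoc del: M.l_neg)
  then have "x \<ominus> z = (x \<ominus> y) \<oplus> (y \<ominus> z)"
    using xyz by (simp add: M.l_neg M.minus_eq)
  then show "hdist H x z \<le> hdist H x y + hdist H y z"
    using xyz hnorm_triangle[of "x \<ominus> y" "y \<ominus> z"] by (simp add: hdist_def)
qed

end

sublocale complex_inner_space \<subseteq> Metric_space "carrier H" "hdist H"
  by (rule Metric_space_hdist)

locale complex_hilbert_space = complex_inner_space +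
  assumes complete: mcomplete

abbreviation htopology :: "('a, 'm) inner_module_scheme \<Rightarrow> 'a topology" where
  "htopology H \<equiv> Metric_space.mtopology (carrier H) (hdist H)"

text \<open>
  Operators are partial functions, so that \<^term>\<open>dom T\<close> is the domain of \<open>T\<close> and
  \<^term>\<open>S \<circ>\<^sub>m R\<close> is the operator product, see \<open>dom_map_comp\<close> below.
\<close>

definition linear_operator :: "('a, 'm) inner_module_scheme \<Rightarrow> ('a \<rightharpoonup> 'a) \<Rightarrow> bool" where
  "linear_operator H T \<longleftrightarrow>
     submodule (dom T) complex_field H \<and> ran T \<subseteq> carrier H \<and>
     (\<forall>x\<in>dom T. \<forall>y\<in>dom T. the (T (x \<oplus>\<^bsub>H\<^esub> y)) = the (T x) \<oplus>\<^bsub>H\<^esub> the (T y)) \<and>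
     (\<forall>a. \<forall>x\<in>dom T. the (T (a \<odot>\<^bsub>H\<^esub> x)) = a \<odot>\<^bsub>H\<^esub> the (T x))"

lemma dom_map_comp: "dom (S \<circ>\<^sub>m R) = {x \<in> dom R. the (R x) \<in> dom S}"
  by (auto simp: map_comp_def dom_def split: option.splits)

definition densely_defined :: "('a, 'm) inner_module_scheme \<Rightarrow> ('a \<rightharpoonup> 'a) \<Rightarrow> bool" where
  "densely_defined H T \<longleftrightarrow> htopology H closure_of dom T = carrier H"

definition bounded_operator :: "('a, 'm) inner_module_scheme \<Rightarrow> ('a \<rightharpoonup> 'a) \<Rightarrow> bool" where
  "bounded_operator H T \<longleftrightarrow> (\<exists>C. \<forall>x\<in>dom T. hnorm H (the (T x)) \<le> C * hnorm H x)"

definition closed_operator :: "('a, 'm) inner_module_scheme \<Rightarrow> ('a \<rightharpoonup> 'a) \<Rightarrow> bool" where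
  "closed_operator H T \<longleftrightarrow> closedin (prod_topology (htopology H) (htopology H)) (Map.graph T)"

text \<open>The vector \<open>z\<close> is unique if \<open>T\<close> is densely defined; the adjoint is only
  meaningful in that case.\<close>

definition adjoint_op :: "('a, 'm) inner_module_scheme \<Rightarrow> ('a \<rightharpoonup> 'a) \<Rightarrow> ('a \<rightharpoonup> 'a)" where
  "adjoint_op H T = (\<lambda>y.
     let is_image = (\<lambda>z. z \<in> carrier H \<and> (\<forall>x\<in>dom T. ip H (the (T x)) y = ip H x z))
     in if y \<in> carrier H \<and> (\<exists>z. is_image z) then Some (THE z. is_image z) else None)"

end

theory Submission
  imports Defs
begin

text \<open>
  Let \<open>H = \<ell>\<^sup>2 \<oplus> \<ell>\<^sup>2\<close>, let \<open>K\<close> be the injective self-adjoint operator on \<open>\<ell>\<^sup>2\<close> with matrix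
  \<open>2\<^bsup>-(n+1)(m+1)\<^esup>\<close>, and let \<open>U\<close> be the self-adjoint unitary with rows \<open>(S, C)\<close> and \<open>(C, -S)\<close>, where
  \<open>S\<close> and \<open>C\<close> are diagonal with entries \<open>s\<^sub>n = 2\<^bsup>-(n+1)(n+1)\<^esup>\<close> and \<open>c\<^sub>n = (-1)\<^sup>n (1 - s\<^sub>n\<^sup>2)\<^bsup>1/2\<^esup>\<close>.
  Put \<open>T = U (K\<inverse> \<oplus> K)\<close>, so that \<open>T\<^sup>* = (K\<inverse> \<oplus> K) U\<close>. For both squares, an element of the domain
  gives a solution of \<open>S y + C K b = K a\<close> in \<open>\<ell>\<^sup>2\<close>, and it vanishes if this solution does.

  Now \<open>(K a)\<^sub>n\<close> is \<open>w f(w)\<close> at \<open>w = 2\<^bsup>-(n+1)\<^esup>\<close>, where \<open>f\<close> is the power series with coefficients \<open>a\<close>; as \<open>s\<^sub>n\<close>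
  decays faster than any power of \<open>w\<close>, this is not \<open>O(s\<^sub>n)\<close> along a subsequence unless \<open>a = 0\<close>. Since
  \<open>c\<^sub>n - (-1)\<^sup>n = O(s\<^sub>n)\<close>, the equation makes \<open>K (a - b)\<close> be \<open>O(s\<^sub>n)\<close> along even \<open>n\<close> and \<open>K (a + b)\<close> along
  odd \<open>n\<close>, so that \<open>a = b = 0\<close>.
\<close>

section \<open>Hilbert spaces\<close>

context complex_inner_space
begin

lemma ip_zero_left [simp]: "y \<in> carrier H \<Longrightarrow> ip H \<zero> y = 0"
  using ip_add_left[of \<zero> \<zero> y] by simp

lemma ip_minus_left:
  assumes "x \<in> carrier H" "y \<in> carrier H"
  shows "ip H (\<ominus> x) y = - ip H x y"
  using ip_add_left[of x "\<ominus> x" y] assms by (simp add: M.r_neg eq_neg_iff_add_eq_0 add.commute)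

lemma ip_diff_left:
  assumes "x \<in> carrier H" "y \<in> carrier H" "z \<in> carrier H"
  shows "ip H (x \<ominus> y) z = ip H x z - ip H y z"
  using assms by (simp add: M.minus_eq ip_add_left ip_minus_left)

lemma ip_diff_right:
  assumes "x \<in> carrier H" "y \<in> carrier H" "z \<in> carrier H"
  shows "ip H z (x \<ominus> y) = ip H z x - ip H z y"
  using assms ip_commute[of z "x \<ominus> y"] ip_commute[of x z] ip_commute[of y z]
  by (simp add: ip_diff_left)

text \<open>Multiplying \<open>x\<close> by the conjugate sign of \<open>ip H x y\<close> turns the
  inner product into its modulus, so the bound on real parts applies. The factor has modulus at most
  1, being 0 when the inner product vanishes.\<close>

lemma norm_ip_le:
  assumes "x \<in> carrier H" "y \<in> carrier H"
  shows "cmod (ip H x y) \<le> hnorm H x * hnorm H y"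
proof -
  define a where "a = cnj (sgn (ip H x y))"
  have a: "a * ip H x y = cmod (ip H x y)"
    using complex_norm_square[of "ip H x y"]
    by (cases "ip H x y = 0")
       (simp_all add: a_def sgn_eq field_simps power2_eq_square)
  have "cmod a \<le> 1"
    by (simp add: a_def norm_sgn)
  have "cmod (ip H x y) = Re (ip H (a \<odot> x) y)"
    using assms by (simp add: ip_smult_left a)
  also have "\<dots> \<le> hnorm H (a \<odot> x) * hnorm H y"
    using assms by (intro Re_ip_le) auto
  also have "\<dots> = cmod a * (hnorm H x * hnorm H y)"
    using assms by (simp add: hnorm_smult)
  also have "\<dots> \<le> 1 * (hnorm H x * hnorm H y)"
    using assms \<open>cmod a \<le> 1\<close> by (intro mult_right_mono) (auto simp: hnorm_nonneg)
  finally show ?thesis by simp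
qed

lemma continuous_map_ip_left:
  assumes u: "u \<in> carrier H"
  shows "continuous_map mtopology euclidean (\<lambda>x. ip H x u)"
  unfolding continuous_map_eq_topcontinuous_at topcontinuous_at_def
proof (intro ballI conjI allI impI)
  fix x V
  assume x: "x \<in> topspace mtopology" and V: "openin euclidean V \<and> ip H x u \<in> V"
  obtain e where e: "e > 0" "\<And>z. dist z (ip H x u) < e \<Longrightarrow> z \<in> V"
    using V by (auto simp: open_dist)
  define r where "r = e / (hnorm H u + 1)"
  have n: "0 \<le> hnorm H u"
    using u by (simp add: hnorm_nonneg)
  have r: "r > 0"
    using e n by (simp add: r_def)
  have "ip H y u \<in> V" if "y \<in> mball x r" for y
  proof (rule e(2))
    have y: "y \<in> carrier H" "hnorm H (y \<ominus> x) < r"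
      using that commute[of y x] x by (auto simp: in_mball hdist_def)
    have "dist (ip H y u) (ip H x u) = cmod (ip H (y \<ominus> x) u)"
      using x y u by (simp add: dist_norm ip_diff_left)
    also have "\<dots> \<le> hnorm H (y \<ominus> x) * hnorm H u"
      using x y u by (intro norm_ip_le) auto
    also have "\<dots> \<le> r * hnorm H u"
      using y n by (intro mult_right_mono) auto
    also have "\<dots> < e"
      using e n by (simp add: r_def field_simps)
    finally show "dist (ip H y u) (ip H x u) < e" .
  qed
  then show "\<exists>U. openin mtopology U \<and> x \<in> U \<and> (\<forall>y\<in>U. ip H y u \<in> V)"
    using r x by (intro exI[of _ "mball x r"]) auto
qed auto

text \<open>Meant for graphs of operators: a graph cut out by equations between continuous
  functionals of argument and value is an intersection of closed sets.\<close>

lemma closedin_ip_eq: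
  assumes "\<And>i. i \<in> I \<Longrightarrow> u i \<in> carrier H" "\<And>i. i \<in> I \<Longrightarrow> v i \<in> carrier H"
  shows "closedin (prod_topology mtopology mtopology)
    {(x, z). x \<in> carrier H \<and> z \<in> carrier H \<and> (\<forall>i\<in>I. ip H x (u i) = ip H z (v i))}"
proof -
  let ?X = "prod_topology mtopology mtopology"
  have 1: "closedin ?X {p \<in> topspace ?X. ip H (fst p) (u i) = ip H (snd p) (v i)}" if "i \<in> I" for i
  proof (rule closedin_continuous_maps_eq[where Y = euclidean])
    show "continuous_map ?X euclidean (\<lambda>p. ip H (fst p) (u i))"
      using continuous_map_compose[OF continuous_map_fst continuous_map_ip_left[OF assms(1)[OF that]]]
      by (simp add: o_def)
    show "continuous_map ?X euclidean (\<lambda>p. ip H (snd p) (v i))"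
      using continuous_map_compose[OF continuous_map_snd continuous_map_ip_left[OF assms(2)[OF that]]]
      by (simp add: o_def)
  qed (simp add: Hausdorff_space_euclidean)
  have "closedin ?X (topspace ?X \<inter> (\<Inter>i\<in>I. {p \<in> topspace ?X. ip H (fst p) (u i) = ip H (snd p) (v i)}))"
  \<comment> \<open>Intersections of closed sets require a nonempty family; without equations the
    set is the whole product space.\<close>
  proof (cases "I = {}")
    case False
    then show ?thesis
      by (intro closedin_Int closedin_topspace closedin_INT 1)
  qed (use closedin_topspace[of ?X] in simp)
  also have "topspace ?X \<inter> (\<Inter>i\<in>I. {p \<in> topspace ?X. ip H (fst p) (u i) = ip H (snd p) (v i)}) =
    {(x, z). x \<in> carrier H \<and> z \<in> carrier H \<and> (\<forall>i\<in>I. ip H x (u i) = ip H z (v i))}"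
    by auto
  finally show ?thesis .
qed

text \<open>The squared norm of \<open>w\<close> minus \<open>t\<close> times \<open>m\<close> is a
  quadratic in \<open>t\<close> whose minimum lies \<open>b\<^sup>2 / n\<close> below its value at
  0, so this drop is at most \<open>e\<^sup>2\<close>. It is the approximate form of the
  orthogonality of the residual at a nearest point.\<close>

lemma Re_ip_le_of_near_minimal:
  assumes w: "w \<in> carrier H" and m: "m \<in> carrier H" and e: "e \<ge> 0"
    and min: "\<And>t. (hnorm H w)\<^sup>2 \<le> (hnorm H (w \<ominus> complex_of_real t \<odot> m))\<^sup>2 + e\<^sup>2"
  shows "\<bar>Re (ip H w m)\<bar> \<le> e * hnorm H m"
proof (cases "m = \<zero>")
  case True
  then show ?thesis
    using w ip_commute[of w \<zero>] e hnorm_nonneg[of \<zero>] by simp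
next
  case False
  define b where "b = Re (ip H w m)"
  define n where "n = Re (ip H m m)"
  define t where "t = b / n"
  have n: "n > 0"
    using ip_pos[OF m False] by (simp add: n_def)
  have "Re (ip H m w) = b"
    using ip_commute[OF w m] by (simp add: b_def)
  then have "(hnorm H (w \<ominus> complex_of_real t \<odot> m))\<^sup>2 = (hnorm H w)\<^sup>2 - 2 * t * b + t\<^sup>2 * n"
    using w m
    unfolding hnorm_power2[OF w]
      hnorm_power2[OF M.minus_closed[OF w smult_closed[OF carrier_complex_field m]]]
    by (simp add: ip_diff_left ip_diff_right ip_smult_left ip_smult_right
        b_def n_def power2_eq_square algebra_simps)
  moreover have "2 * t * b - t\<^sup>2 * n = b\<^sup>2 / n"
    using n by (simp add: t_def power2_eq_square field_simps)
  ultimately have "b\<^sup>2 / n \<le> e\<^sup>2"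
    using min[of t] by simp
  then have "b\<^sup>2 \<le> (e * hnorm H m)\<^sup>2"
    using n m by (simp add: field_simps hnorm_power2 n_def)
  moreover have "0 \<le> e * hnorm H m"
    using e m by (simp add: hnorm_nonneg)
  ultimately show ?thesis
    using abs_le_square_iff[of b "e * hnorm H m"] by (simp add: b_def)
qed

end

text \<open>If a ball around \<open>u\<close> misses \<open>M\<close>, take points
  \<open>p k\<close> of \<open>M\<close> whose distances to \<open>u\<close> approach the infimum.
  The residuals \<open>w k\<close> are almost orthogonal to \<open>M\<close> and form a Cauchy
  sequence; their limit is orthogonal to \<open>M\<close>, hence zero, although all residuals have
  norm at least \<open>r\<close>.\<close>

lemma (in complex_hilbert_space) dense_if_orthogonal_trivial:
  assumes M: "submodule M complex_field H"
    and orth: "\<And>w. w \<in> carrier H \<Longrightarrow> (\<And>m. m \<in> M \<Longrightarrow> ip H m w = 0) \<Longrightarrow> w = \<zero>"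
  shows "mtopology closure_of M = carrier H"
proof -
  note sub = submoduleE[OF M]
  have MH: "m \<in> carrier H" if "m \<in> M" for m
    using sub(1) that by auto
  have "\<exists>y\<in>M. y \<in> mball u r" if u: "u \<in> carrier H" and r: "r > 0" for u r
  proof (rule ccontr)
    assume "\<not> ?thesis"
    then have far: "r \<le> hnorm H (u \<ominus> m)" if "m \<in> M" for m
      using that u MH[OF that] by (fastforce simp: in_mball hdist_def)
    define N where "N = (\<lambda>m. (hnorm H (u \<ominus> m))\<^sup>2) ` M"
    have N: "N \<noteq> {}" "bdd_below N"
      using sub(2) by (auto simp: N_def intro!: bdd_belowI[of _ 0])
    define d where "d = Inf N"
    \<comment> \<open>The square root makes \<open>(e k)\<^sup>2\<close> the excess over the infimum
      of the squared distances, so that near-orthogonality comes out linear in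
      \<open>e k\<close>.\<close>
    define e where "e = (\<lambda>k::nat. sqrt (inverse (Suc k)))"
    have e: "e k \<ge> 0" "(e k)\<^sup>2 = inverse (Suc k)" for k
      by (auto simp: e_def)
    have "\<exists>m\<in>M. (hnorm H (u \<ominus> m))\<^sup>2 < d + (e k)\<^sup>2" for k
      using cInf_lessD[OF N(1), of "d + (e k)\<^sup>2"] unfolding e(2) by (auto simp: d_def N_def)
    then obtain p where p: "\<And>k. p k \<in> M" "\<And>k. (hnorm H (u \<ominus> p k))\<^sup>2 < d + (e k)\<^sup>2"
      by metis
    define w where "w = (\<lambda>k. u \<ominus> p k)"
    have w: "w k \<in> carrier H" for k
      using u MH[OF p(1)] by (simp add: w_def)
    have key: "\<bar>Re (ip H (w k) m)\<bar> \<le> e k * hnorm H m" if m: "m \<in> M" for k m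
    proof (rule Re_ip_le_of_near_minimal)
      fix t
      have "w k \<ominus> complex_of_real t \<odot> m = u \<ominus> (p k \<oplus> complex_of_real t \<odot> m)"
        using u MH[OF p(1)[of k]] MH[OF m] by (simp add: w_def M.minus_eq M.minus_add M.a_assoc)
      moreover have "p k \<oplus> complex_of_real t \<odot> m \<in> M"
        using p m sub by auto
      ultimately have "(hnorm H (w k \<ominus> complex_of_real t \<odot> m))\<^sup>2 \<in> N"
        by (auto simp: N_def)
      then have "d \<le> (hnorm H (w k \<ominus> complex_of_real t \<odot> m))\<^sup>2"
        unfolding d_def using N by (intro cInf_lower)
      then show "(hnorm H (w k))\<^sup>2 \<le> (hnorm H (w k \<ominus> complex_of_real t \<odot> m))\<^sup>2 + (e k)\<^sup>2"
        using p(2)[of k] by (simp add: w_def)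
    qed (use w MH m e in auto)
    \<comment> \<open>The difference of two residuals lies in \<open>M\<close>, so both are almost
      orthogonal to it; one factor of its norm then cancels.\<close>
    have diff: "hnorm H (w k \<ominus> w l) \<le> e k + e l" for k l
    proof -
      define m where "m = w k \<ominus> w l"
      have "m = p l \<ominus> p k"
        using u MH[OF p(1)[of k]] MH[OF p(1)[of l]]
        by (simp add: m_def w_def M.minus_eq M.minus_add M.a_ac M.r_neg M.r_neg1 M.r_neg2)
      then have m: "m \<in> M"
        using p sub by (simp add: M.minus_eq)
      have "(hnorm H m)\<^sup>2 = Re (ip H (w k) m) - Re (ip H (w l) m)"
        using w m MH by (simp add: hnorm_power2 m_def ip_diff_left)
      also have "\<dots> \<le> (e k + e l) * hnorm H m"
        using key[OF m, of k] key[OF m, of l] by (simp add: algebra_simps)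
      finally have "hnorm H m * hnorm H m \<le> (e k + e l) * hnorm H m"
        by (simp add: power2_eq_square)
      then show ?thesis
        using hnorm_nonneg[OF MH[OF m]] e(1)[of k] e(1)[of l]
        by (cases "hnorm H m = 0") (auto simp: m_def[symmetric])
    qed
    have e0: "e \<longlonglongrightarrow> 0"
      unfolding e_def using tendsto_real_sqrt[OF LIMSEQ_inverse_real_of_nat] by simp
    have "MCauchy w"
      unfolding MCauchy_def
    proof (intro conjI allI impI)
      fix s :: real
      assume "s > 0"
      then obtain K where K: "\<And>k. k \<ge> K \<Longrightarrow> e k < s / 2"
        using order_tendstoD(2)[OF e0, of "s / 2"] by (auto simp: eventually_sequentially)
      have "hdist H (w k) (w l) < s" if "K \<le> k" "K \<le> l" for k l
        using K[OF that(1)] K[OF that(2)] diff[of k l] w by (simp add: hdist_def)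
      then show "\<exists>N. \<forall>n n'. N \<le> n \<longrightarrow> N \<le> n' \<longrightarrow> hdist H (w n) (w n') < s"
        by blast
    qed (use w in auto)
    then obtain v where v: "limitin mtopology w v sequentially"
      using complete by (auto simp: mcomplete_def)
    then have vH: "v \<in> carrier H"
      by (simp add: limitin_metric)
    have dist0: "(\<lambda>k. hnorm H (w k \<ominus> v)) \<longlonglongrightarrow> 0"
    proof (rule LIMSEQ_I)
      fix s :: real
      assume "s > 0"
      then obtain K where "\<And>k. k \<ge> K \<Longrightarrow> hdist H (w k) v < s"
        using v unfolding limit_metric_sequentially by blast
      then show "\<exists>K. \<forall>k\<ge>K. norm (hnorm H (w k \<ominus> v) - 0) < s"
        using w vH by (intro exI[of _ K]) (auto simp: hdist_def hnorm_nonneg)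
    qed
    have Re0: "Re (ip H v m) = 0" if m: "m \<in> M" for m
    proof -
      have "\<bar>Re (ip H v m)\<bar> \<le> hnorm H (w k \<ominus> v) * hnorm H m + e k * hnorm H m" for k
      proof -
        have "Re (ip H v m) = Re (ip H (w k) m) - Re (ip H (w k \<ominus> v) m)"
          using w vH MH[OF m] by (simp add: ip_diff_left)
        moreover have "\<bar>Re (ip H (w k \<ominus> v) m)\<bar> \<le> hnorm H (w k \<ominus> v) * hnorm H m"
          using order_trans[OF abs_Re_le_cmod norm_ip_le] w vH MH[OF m] by simp
        ultimately show ?thesis
          using key[OF m, of k] by linarith
      qed
      moreover have "(\<lambda>k. hnorm H (w k \<ominus> v) * hnorm H m + e k * hnorm H m) \<longlonglongrightarrow> 0"
        using tendsto_add[OF tendsto_mult_right[OF dist0] tendsto_mult_right[OF e0]] by simp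
      ultimately have "\<bar>Re (ip H v m)\<bar> \<le> 0"
        by (intro LIMSEQ_le_const) auto
      then show ?thesis by simp
    qed
    have "ip H m v = 0" if m: "m \<in> M" for m
    proof -
      \<comment> \<open>Minimality along real multiples controls only real parts; the imaginary part
        is the real part for \<open>\<i>\<close> times \<open>m\<close>.\<close>
      have "\<i> \<odot> m \<in> M"
        using sub m by auto
      then have "Im (ip H v m) = 0"
        using Re0[of "\<i> \<odot> m"] vH MH[OF m] by (simp add: ip_smult_right)
      then have "ip H v m = 0"
        using Re0[OF m] by (simp add: complex_eq_iff)
      then show ?thesis
        using ip_commute[of m v] vH MH[OF m] by simp
    qed
    then have "v = \<zero>"
      using orth vH by blast
    then have "(\<lambda>k. hnorm H (w k)) \<longlonglongrightarrow> 0"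
      using dist0 w M.minus_equality[of \<zero> \<zero>] by (simp add: M.minus_eq)
    then have "r \<le> 0"
      using far p by (intro LIMSEQ_le_const) (auto simp: w_def)
    with r show False by simp
  qed
  then show ?thesis
    unfolding metric_closure_of by blast
qed

section \<open>The space of square-summable sequences\<close>

definition square_summable :: "(nat \<Rightarrow> complex) set" where
  "square_summable = {x. summable (\<lambda>n. (cmod (x n))\<^sup>2)}"

definition ell2 :: "(nat \<Rightarrow> complex) inner_module" where
  "ell2 = \<lparr>carrier = square_summable, mult = (\<lambda>_ _ _. 0), one = (\<lambda>_. 0), zero = (\<lambda>_. 0),
     add = (\<lambda>x y n. x n + y n), smult = (\<lambda>a x n. a * x n), ip = (\<lambda>x y. \<Sum>n. x n * cnj (y n))\<rparr>"

lemma ell2_sel [simp]: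
  "carrier ell2 = square_summable"
  "\<zero>\<^bsub>ell2\<^esub> = (\<lambda>_. 0)"
  "x \<oplus>\<^bsub>ell2\<^esub> y = (\<lambda>n. x n + y n)"
  "a \<odot>\<^bsub>ell2\<^esub> x = (\<lambda>n. a * x n)"
  by (simp_all add: ell2_def)

lemma ip_ell2: "ip ell2 x y = (\<Sum>n. x n * cnj (y n))"
  by (simp add: ell2_def)

lemma ip_ell2_zero [simp]: "ip ell2 (\<lambda>_. 0) x = 0" "ip ell2 x (\<lambda>_. 0) = 0"
  by (simp_all add: ip_ell2)

lemma square_summable_zero [simp]: "(\<lambda>_. 0) \<in> square_summable"
  by (simp add: square_summable_def)

lemma square_summable_dominated:
  assumes "y \<in> square_summable" "\<And>n. cmod (x n) \<le> c * cmod (y n)"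
  shows "x \<in> square_summable"
proof -
  have "(cmod (x n))\<^sup>2 \<le> c\<^sup>2 * (cmod (y n))\<^sup>2" for n
    using power_mono[OF assms(2)[of n], of 2] by (simp add: power_mult_distrib)
  moreover have "summable (\<lambda>n. c\<^sup>2 * (cmod (y n))\<^sup>2)"
    using assms(1) by (simp add: square_summable_def summable_mult)
  ultimately show ?thesis
    unfolding square_summable_def mem_Collect_eq
    by (auto intro: summable_comparison_test'[where N = 0 and g = "\<lambda>n. c\<^sup>2 * (cmod (y n))\<^sup>2"])
qed

lemma square_summable_mult [simp]: "x \<in> square_summable \<Longrightarrow> (\<lambda>n. a * x n) \<in> square_summable"
  by (rule square_summable_dominated[of x _ "cmod a"]) (auto simp: norm_mult)

lemma square_summable_uminus [simp]: "x \<in> square_summable \<Longrightarrow> (\<lambda>n. - x n) \<in> square_summable"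
  by (simp add: square_summable_def)

lemma square_summable_add [simp]:
  assumes "x \<in> square_summable" "y \<in> square_summable"
  shows "(\<lambda>n. x n + y n) \<in> square_summable"
proof -
  have "(cmod (x n + y n))\<^sup>2 \<le> 2 * (cmod (x n))\<^sup>2 + 2 * (cmod (y n))\<^sup>2" for n
  proof -
    have "(cmod (x n + y n))\<^sup>2 \<le> (cmod (x n) + cmod (y n))\<^sup>2"
      by (intro power_mono norm_triangle_ineq) auto
    also have "\<dots> \<le> 2 * (cmod (x n))\<^sup>2 + 2 * (cmod (y n))\<^sup>2"
      using sum_squares_bound[of "cmod (x n)" "cmod (y n)"] by (simp add: power2_sum)
    finally show ?thesis .
  qed
  moreover have "summable (\<lambda>n. 2 * (cmod (x n))\<^sup>2 + 2 * (cmod (y n))\<^sup>2)"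
    using assms by (intro summable_add summable_mult) (auto simp: square_summable_def)
  ultimately show ?thesis
    unfolding square_summable_def mem_Collect_eq
    by (auto intro: summable_comparison_test'[where N = 0 and
        g = "\<lambda>n. 2 * (cmod (x n))\<^sup>2 + 2 * (cmod (y n))\<^sup>2"])
qed

lemma square_summable_diff [simp]:
  assumes "x \<in> square_summable" "y \<in> square_summable"
  shows "(\<lambda>n. x n - y n) \<in> square_summable"
  using square_summable_add[OF assms(1) square_summable_uminus[OF assms(2)]] by simp

lemma summable_ell2_ip:
  assumes "x \<in> square_summable" "y \<in> square_summable"
  shows "summable (\<lambda>n. x n * cnj (y n))"
proof -
  have "cmod (x n * cnj (y n)) \<le> (cmod (x n))\<^sup>2 + (cmod (y n))\<^sup>2" for n
  proof -
    have "cmod (x n) * cmod (y n) \<ge> 0"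
      by simp
    then show ?thesis
      unfolding norm_mult complex_mod_cnj
      using sum_squares_bound[of "cmod (x n)" "cmod (y n)"] by linarith
  qed
  moreover have "summable (\<lambda>n. (cmod (x n))\<^sup>2 + (cmod (y n))\<^sup>2)"
    using assms by (intro summable_add) (auto simp: square_summable_def)
  ultimately show ?thesis
    by (auto intro: summable_comparison_test'[where N = 0 and g = "\<lambda>n. (cmod (x n))\<^sup>2 + (cmod (y n))\<^sup>2"])
qed

lemma ip_ell2_self:
  assumes "x \<in> square_summable"
  shows "ip ell2 x x = of_real (\<Sum>n. (cmod (x n))\<^sup>2)"
  using assms by (simp add: ip_ell2 suminf_of_real square_summable_def flip: complex_norm_square)

lemma module_ell2: "module complex_field ell2"
proof (rule moduleI)
  show "cring (complex_field)"
    by (rule cring_from_type_algebra)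
  show "abelian_group ell2"
  proof (rule abelian_groupI)
    fix x
    assume "x \<in> carrier ell2"
    then show "\<exists>y\<in>carrier ell2. y \<oplus>\<^bsub>ell2\<^esub> x = \<zero>\<^bsub>ell2\<^esub>"
      by (intro bexI[of _ "\<lambda>n. - x n"]) auto
  qed (auto simp: algebra_simps)
qed (auto simp: ring_of_type_algebra_def algebra_simps)

interpretation ell2: complex_inner_space ell2
proof -
  interpret module complex_field ell2
    by (rule module_ell2)
  show "complex_inner_space ell2"
  proof
    fix x y z :: "nat \<Rightarrow> complex" and a
    assume x: "x \<in> carrier ell2" and y: "y \<in> carrier ell2"
    show "ip ell2 (a \<odot>\<^bsub>ell2\<^esub> x) y = a * ip ell2 x y"
      using x y by (simp add: ip_ell2 mult.assoc suminf_mult summable_ell2_ip)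
    show "ip ell2 x y = cnj (ip ell2 y x)"
      using bounded_linear.suminf[OF bounded_linear_cnj summable_ell2_ip[of y x]] x y
      by (simp add: ip_ell2 mult.commute)
    assume z: "z \<in> carrier ell2"
    show "ip ell2 (x \<oplus>\<^bsub>ell2\<^esub> y) z = ip ell2 x z + ip ell2 y z"
      using x y z by (simp add: ip_ell2 distrib_right suminf_add summable_ell2_ip)
  next
    fix x :: "nat \<Rightarrow> complex"
    assume x: "x \<in> carrier ell2" and "x \<noteq> \<zero>\<^bsub>ell2\<^esub>"
    then obtain n where "x n \<noteq> 0"
      by auto
    then show "0 < Re (ip ell2 x x)"
      unfolding ip_ell2_self[OF x[unfolded ell2_sel]] Re_complex_of_real
      using x by (intro suminf_pos2[of _ n]) (auto simp: square_summable_def)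
  qed
qed

lemma hnorm_ell2: "x \<in> square_summable \<Longrightarrow> hnorm ell2 x = sqrt (\<Sum>n. (cmod (x n))\<^sup>2)"
  unfolding hnorm_def by (subst ip_ell2_self) auto

lemma ell2_uminus: "x \<in> square_summable \<Longrightarrow> \<ominus>\<^bsub>ell2\<^esub> x = (\<lambda>n. - x n)"
  by (intro ell2.M.minus_equality) auto

lemma ell2_minus:
  assumes "x \<in> square_summable" "y \<in> square_summable"
  shows "x \<ominus>\<^bsub>ell2\<^esub> y = (\<lambda>n. x n - y n)"
  using assms by (simp add: ell2.M.minus_eq ell2_uminus)

text \<open>Finite partial sums replace the series because bounds on them pass to coordinatewise
  limits.\<close>

lemma hdist_ell2_le_iff:
  assumes "x \<in> square_summable" "y \<in> square_summable" "e \<ge> 0"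
  shows "hdist ell2 x y \<le> e \<longleftrightarrow> (\<forall>N. (\<Sum>n<N. (cmod (x n - y n))\<^sup>2) \<le> e\<^sup>2)"
proof -
  have sm: "summable (\<lambda>n. (cmod (x n - y n))\<^sup>2)"
    using square_summable_diff[OF assms(1,2)] by (simp add: square_summable_def)
  have "hdist ell2 x y \<le> e \<longleftrightarrow> (\<Sum>n. (cmod (x n - y n))\<^sup>2) \<le> e\<^sup>2"
    using assms by (simp add: hdist_def ell2_minus hnorm_ell2 real_sqrt_le_iff' suminf_nonneg sm)
  also have "\<dots> \<longleftrightarrow> (\<forall>N. (\<Sum>n<N. (cmod (x n - y n))\<^sup>2) \<le> e\<^sup>2)"
    using sm by (auto intro: suminf_le_const order_trans[OF sum_le_suminf])
  finally show ?thesis .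
qed

text \<open>Completeness: the coordinates of a Cauchy sequence converge, and letting one of the two
  indices tend to infinity in the Cauchy bound on partial sums bounds the distance to the
  coordinatewise limit.\<close>

interpretation ell2: complex_hilbert_space ell2
proof
  show "ell2.mcomplete"
    unfolding ell2.mcomplete_def
  proof (intro allI impI)
    fix \<sigma> :: "nat \<Rightarrow> nat \<Rightarrow> complex"
    assume cau: "ell2.MCauchy \<sigma>"
    then have S: "\<sigma> k \<in> square_summable" for k
      unfolding ell2.MCauchy_def by auto
    have unif: "\<exists>K. \<forall>k\<ge>K. \<forall>l\<ge>K. \<forall>N. (\<Sum>n<N. (cmod (\<sigma> k n - \<sigma> l n))\<^sup>2) \<le> e\<^sup>2" if "e > 0" for e
    proof -
      obtain K where "\<And>k l. K \<le> k \<Longrightarrow> K \<le> l \<Longrightarrow> hdist ell2 (\<sigma> k) (\<sigma> l) < e"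
        using cau \<open>e > 0\<close> unfolding ell2.MCauchy_def by blast
      then show ?thesis
        using hdist_ell2_le_iff[OF S S, of e] \<open>e > 0\<close> by (metis less_le)
    qed
    have "Cauchy (\<lambda>k. \<sigma> k n)" for n
    proof (rule metric_CauchyI)
      fix e :: real
      assume "e > 0"
      then obtain K where K: "\<And>k l N. k \<ge> K \<Longrightarrow> l \<ge> K \<Longrightarrow> (\<Sum>n<N. (cmod (\<sigma> k n - \<sigma> l n))\<^sup>2) \<le> (e / 2)\<^sup>2"
        using unif[of "e / 2"] by auto
      have "dist (\<sigma> k n) (\<sigma> l n) < e" if "k \<ge> K" "l \<ge> K" for k l
      proof -
        have "(cmod (\<sigma> k n - \<sigma> l n))\<^sup>2 \<le> (e / 2)\<^sup>2"
          using K[OF that, of "Suc n"] sum_nonneg[of "{..<n}" "\<lambda>n. (cmod (\<sigma> k n - \<sigma> l n))\<^sup>2"]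
          by simp
        then have "cmod (\<sigma> k n - \<sigma> l n) \<le> e / 2"
          by (rule power2_le_imp_le) (use \<open>e > 0\<close> in simp)
        with \<open>e > 0\<close> show ?thesis
          by (simp add: dist_norm)
      qed
      then show "\<exists>K. \<forall>k\<ge>K. \<forall>l\<ge>K. dist (\<sigma> k n) (\<sigma> l n) < e"
        by blast
    qed
    then have "\<exists>a. (\<lambda>k. \<sigma> k n) \<longlonglongrightarrow> a" for n
      by (meson Cauchy_convergent convergent_def)
    then obtain x where x: "\<And>n. (\<lambda>k. \<sigma> k n) \<longlonglongrightarrow> x n"
      by metis
    have near: "\<exists>K. \<forall>k\<ge>K. \<forall>N. (\<Sum>n<N. (cmod (\<sigma> k n - x n))\<^sup>2) \<le> e\<^sup>2" if e: "e > 0" for e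
    proof -
      obtain K where K: "\<And>k l N. k \<ge> K \<Longrightarrow> l \<ge> K \<Longrightarrow> (\<Sum>n<N. (cmod (\<sigma> k n - \<sigma> l n))\<^sup>2) \<le> e\<^sup>2"
        using unif[OF e] by auto
      have "(\<Sum>n<N. (cmod (\<sigma> k n - x n))\<^sup>2) \<le> e\<^sup>2" if "k \<ge> K" for k N
      proof (rule LIMSEQ_le_const2)
        show "(\<lambda>l. \<Sum>n<N. (cmod (\<sigma> k n - \<sigma> l n))\<^sup>2) \<longlonglongrightarrow> (\<Sum>n<N. (cmod (\<sigma> k n - x n))\<^sup>2)"
          by (intro tendsto_intros x)
        show "\<exists>L. \<forall>l\<ge>L. (\<Sum>n<N. (cmod (\<sigma> k n - \<sigma> l n))\<^sup>2) \<le> e\<^sup>2"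
          using K that by blast
      qed
      then show ?thesis by blast
    qed
    \<comment> \<open>One index with bounded error puts \<open>x\<close> into the space, as the
      difference of \<open>\<sigma> k\<close> and a square-summable sequence.\<close>
    obtain k where "\<And>N. (\<Sum>n<N. (cmod (\<sigma> k n - x n))\<^sup>2) \<le> 1"
      using near[of 1] by auto
    then have "(\<lambda>n. \<sigma> k n - x n) \<in> square_summable"
      unfolding square_summable_def mem_Collect_eq
      by (intro bounded_imp_summable[where B = 1])
         (auto simp: lessThan_Suc_atMost[symmetric] simp del: sum.lessThan_Suc)
    from square_summable_diff[OF S[of k] this] have xS: "x \<in> square_summable"
      by simp
    have "\<exists>K. \<forall>k\<ge>K. hdist ell2 (\<sigma> k) x < e" if "e > 0" for e
    proof -
      obtain K where "\<And>k N. k \<ge> K \<Longrightarrow> (\<Sum>n<N. (cmod (\<sigma> k n - x n))\<^sup>2) \<le> (e / 2)\<^sup>2"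
        using near[of "e / 2"] \<open>e > 0\<close> by auto
      then have "\<forall>k\<ge>K. hdist ell2 (\<sigma> k) x \<le> e / 2"
        using hdist_ell2_le_iff[OF S xS, of "e / 2"] \<open>e > 0\<close> by auto
      with \<open>e > 0\<close> show ?thesis
        by (intro exI[of _ K]) fastforce
    qed
    then show "\<exists>x. limitin ell2.mtopology \<sigma> x sequentially"
      unfolding ell2.limit_metric_sequentially using S xS by (intro exI[of _ x]) auto
  qed
qed

definition unit_seq :: "nat \<Rightarrow> nat \<Rightarrow> complex" where
  "unit_seq m = (\<lambda>n. if n = m then 1 else 0)"

lemma square_summable_unit_seq [simp]: "unit_seq m \<in> square_summable"
proof -
  have "(\<lambda>n. (cmod (unit_seq m n))\<^sup>2) = (\<lambda>n. if n = m then 1 else 0)"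
    by (auto simp: unit_seq_def)
  then show ?thesis
    by (simp add: square_summable_def)
qed

lemma ip_unit_seq: "ip ell2 x (unit_seq m) = x m"
proof -
  have "(\<lambda>n. x n * cnj (unit_seq m n)) = (\<lambda>n. if n = m then x n else 0)"
    by (auto simp: unit_seq_def)
  then show ?thesis
    using sums_unique[OF sums_single[of m x]] by (simp add: ip_ell2)
qed

lemma hnorm_unit_seq: "hnorm ell2 (unit_seq m) = 1"
  unfolding hnorm_def by (subst ip_unit_seq) (simp add: unit_seq_def)

lemma norm_le_hnorm:
  assumes "x \<in> square_summable"
  shows "cmod (x n) \<le> hnorm ell2 x"
  using ell2.norm_ip_le[of x "unit_seq n"] assms
  by (simp add: ip_unit_seq hnorm_unit_seq)

section \<open>The square-summable sequences as a direct sum of two copies of themselves\<close>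

definition evens :: "(nat \<Rightarrow> complex) \<Rightarrow> nat \<Rightarrow> complex" where
  "evens x = (\<lambda>n. x (2 * n))"

definition odds :: "(nat \<Rightarrow> complex) \<Rightarrow> nat \<Rightarrow> complex" where
  "odds x = (\<lambda>n. x (Suc (2 * n)))"

text \<open>The pair of sequences is coded as one sequence, so that the direct sum is again
  \<open>ell2\<close> and its Hilbert space structure is available.\<close>

definition interleave :: "(nat \<Rightarrow> complex) \<Rightarrow> (nat \<Rightarrow> complex) \<Rightarrow> nat \<Rightarrow> complex" where
  "interleave a b = (\<lambda>n. if even n then a (n div 2) else b (n div 2))"

lemma evens_interleave [simp]: "evens (interleave a b) = a"
  by (simp add: evens_def interleave_def)

lemma odds_interleave [simp]: "odds (interleave a b) = b"
  by (simp add: odds_def interleave_def)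

lemma interleave_evens_odds [simp]: "interleave (evens x) (odds x) = x"
  by (auto simp: evens_def odds_def interleave_def fun_eq_iff)

lemma interleave_add:
  "(\<lambda>n. interleave a b n + interleave a' b' n) = interleave (\<lambda>n. a n + a' n) (\<lambda>n. b n + b' n)"
  by (auto simp: interleave_def)

lemma interleave_mult: "(\<lambda>n. c * interleave a b n) = interleave (\<lambda>n. c * a n) (\<lambda>n. c * b n)"
  by (auto simp: interleave_def)

lemma interleave_zero [simp]: "interleave (\<lambda>_. 0) (\<lambda>_. 0) = (\<lambda>_. 0)"
  by (auto simp: interleave_def)

lemma square_summable_evens [simp]:
  assumes "x \<in> square_summable" shows "evens x \<in> square_summable"
  using assms summable_reindex[of "\<lambda>n. (cmod (x n))\<^sup>2" "\<lambda>n. 2 * n"]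
  by (simp add: square_summable_def evens_def o_def inj_on_def)

lemma square_summable_odds [simp]:
  assumes "x \<in> square_summable" shows "odds x \<in> square_summable"
  using assms summable_reindex[of "\<lambda>n. (cmod (x n))\<^sup>2" "\<lambda>n. Suc (2 * n)"]
  by (simp add: square_summable_def odds_def o_def inj_on_def)

lemma square_summable_interleave [simp]:
  assumes "a \<in> square_summable" "b \<in> square_summable"
  shows "interleave a b \<in> square_summable"
proof -
  have "summable (\<lambda>n. if even n then (cmod (a (n div 2)))\<^sup>2 else (cmod (b ((n - 1) div 2)))\<^sup>2)"
    using assms by (intro sums_summable[OF sums_if] summable_sums) (auto simp: square_summable_def)
  also have "(\<lambda>n. if even n then (cmod (a (n div 2)))\<^sup>2 else (cmod (b ((n - 1) div 2)))\<^sup>2)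
      = (\<lambda>n. (cmod (interleave a b n))\<^sup>2)"
    by (auto simp: interleave_def fun_eq_iff elim!: oddE)
  finally show ?thesis
    by (simp add: square_summable_def)
qed

text \<open>The series is grouped into consecutive pairs. A single series of pairs allows operators
  acting on each pair to be compared term by term.\<close>

lemma ip_evens_odds:
  assumes "x \<in> square_summable" "y \<in> square_summable"
  shows "ip ell2 x y = (\<Sum>n. evens x n * cnj (evens y n) + odds x n * cnj (odds y n))"
proof -
  have "(\<lambda>n. \<Sum>k = n * 2..<n * 2 + 2. x k * cnj (y k)) sums ip ell2 x y"
    using sums_group[OF summable_sums[OF summable_ell2_ip[OF assms]], of 2] by (simp add: ip_ell2)
  then show ?thesis
    by (intro sums_unique) (simp add: evens_def odds_def mult.commute[of _ 2] numeral_2_eq_2)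
qed

lemma ip_interleave_right:
  assumes "x \<in> square_summable" "a \<in> square_summable" "b \<in> square_summable"
  shows "ip ell2 x (interleave a b) = ip ell2 (evens x) a + ip ell2 (odds x) b"
  by (subst ip_evens_odds) (use assms in \<open>auto simp: ip_ell2 suminf_add summable_ell2_ip\<close>)

lemma ip_interleave_left:
  assumes "x \<in> square_summable" "a \<in> square_summable" "b \<in> square_summable"
  shows "ip ell2 (interleave a b) x = ip ell2 a (evens x) + ip ell2 b (odds x)"
  by (subst ip_evens_odds) (use assms in \<open>auto simp: ip_ell2 suminf_add summable_ell2_ip\<close>)

section \<open>The moment operator\<close>

definition moment_row :: "nat \<Rightarrow> nat \<Rightarrow> complex" where
  "moment_row n = (\<lambda>m. (1/2) ^ (Suc n * Suc m))"

text \<open>As an inner product, each entry is linear in \<open>a\<close> and falls under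
  Cauchy-Schwarz; the row is real, so the conjugation in the second argument does not alter
  it.\<close>

definition moment_op :: "(nat \<Rightarrow> complex) \<Rightarrow> nat \<Rightarrow> complex" where
  "moment_op a = (\<lambda>n. ip ell2 a (moment_row n))"

lemma moment_row_sums:
  "(\<lambda>m. (cmod (moment_row n m))\<^sup>2) sums ((1/4) ^ Suc n / (1 - (1/4) ^ Suc n))"
proof -
  define r :: real where "r = (1/4) ^ Suc n"
  have q: "(1/2 :: real)\<^sup>2 = 1/4"
    by (simp add: power2_eq_square)
  have "(cmod (moment_row n m))\<^sup>2 = r * r ^ m" for m
  proof -
    have "(cmod (moment_row n m))\<^sup>2 = ((1/2) ^ (Suc n * Suc m))\<^sup>2"
      by (simp add: moment_row_def norm_power norm_divide del: power_Suc mult_Suc mult_Suc_right)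
    also have "\<dots> = ((1/2)\<^sup>2) ^ (Suc n * Suc m)"
      unfolding power_mult[symmetric] by (simp only: mult.commute)
    also have "\<dots> = r ^ Suc m"
      using power_mult[of "1/4 :: real" "Suc n" "Suc m"] by (simp only: r_def q)
    finally show ?thesis by simp
  qed
  moreover have "norm r < 1"
    using power_le_one[of "1/4 :: real" n] by (simp add: r_def)
  then have "(\<lambda>m. r * r ^ m) sums (r * (1 / (1 - r)))"
    by (intro sums_mult geometric_sums)
  ultimately show ?thesis
    by (simp only: r_def[symmetric] times_divide_eq_right mult_1_right)
qed

lemma square_summable_moment_row [simp]: "moment_row n \<in> square_summable"
  using moment_row_sums by (auto simp: square_summable_def dest: sums_summable)

text \<open>The geometric series gives the square \<open>(s / 4) / (1 - s / 4)\<close> with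
  \<open>s = (1/4) ^ n\<close>, at most \<open>s\<close> since \<open>s \<le> 1\<close>. The decay
  in \<open>n\<close> makes images under \<open>moment_op\<close> square-summable and later shows
  that the operator is unbounded.\<close>

lemma hnorm_moment_row: "hnorm ell2 (moment_row n) \<le> (1/2) ^ n"
proof (rule power2_le_imp_le)
  define s :: real where "s = (1/4) ^ n"
  have "0 < s" "s \<le> 1"
    by (auto simp: s_def power_le_one_iff)
  have "(hnorm ell2 (moment_row n))\<^sup>2 = (s / 4) / (1 - s / 4)"
    using sums_unique[OF moment_row_sums[of n]] ell2.hnorm_nonneg[of "moment_row n"]
    by (simp add: hnorm_ell2 s_def suminf_nonneg sums_summable[OF moment_row_sums])
  also have "\<dots> \<le> s"
    using \<open>0 < s\<close> \<open>s \<le> 1\<close> mult_left_le[of s s] by (simp add: field_simps)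
  also have "s = ((1/2) ^ n)\<^sup>2"
    by (simp add: s_def power2_eq_square flip: power_mult_distrib)
  finally show "(hnorm ell2 (moment_row n))\<^sup>2 \<le> ((1/2) ^ n)\<^sup>2" .
qed simp

lemma square_summable_moment_op [simp]:
  assumes "a \<in> square_summable"
  shows "moment_op a \<in> square_summable"
proof (rule square_summable_dominated)
  have "(\<lambda>n. (cmod ((1/2) ^ n))\<^sup>2) = (\<lambda>n. (1/4) ^ n)"
    by (auto simp: norm_power norm_divide power2_eq_square simp flip: power_mult_distrib)
  then show "(\<lambda>n. (1/2) ^ n) \<in> square_summable"
    by (simp add: square_summable_def summable_geometric)
  show "cmod (moment_op a n) \<le> hnorm ell2 a * cmod ((1/2) ^ n)" for n
  proof -
    have "cmod (moment_op a n) \<le> hnorm ell2 a * hnorm ell2 (moment_row n)"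
      unfolding moment_op_def using assms by (intro ell2.norm_ip_le) auto
    also have "\<dots> \<le> hnorm ell2 a * (1/2) ^ n"
      using assms by (intro mult_left_mono hnorm_moment_row ell2.hnorm_nonneg) auto
    finally show ?thesis
      by (simp add: norm_power norm_divide)
  qed
qed

lemma moment_op_add:
  assumes "a \<in> square_summable" "b \<in> square_summable"
  shows "moment_op (\<lambda>n. a n + b n) = (\<lambda>n. moment_op a n + moment_op b n)"
  using ell2.ip_add_left[of a b] assms by (simp add: moment_op_def)

lemma moment_op_mult:
  assumes "a \<in> square_summable"
  shows "moment_op (\<lambda>n. c * a n) = (\<lambda>n. c * moment_op a n)"
  using ell2.ip_smult_left[of a _ c] assms by (simp add: moment_op_def)

lemma moment_op_zero [simp]: "moment_op (\<lambda>_. 0) = (\<lambda>_. 0)"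
  by (simp add: moment_op_def)

lemma moment_op_unit_seq: "moment_op (unit_seq m) = moment_row m"
proof
  fix n
  have "moment_op (unit_seq m) n = cnj (moment_row n m)"
    unfolding moment_op_def using ell2.ip_commute[of "unit_seq m" "moment_row n"]
    by (simp add: ip_unit_seq)
  then show "moment_op (unit_seq m) n = moment_row m n"
    by (simp add: moment_row_def mult.commute[of "Suc n" "Suc m"] del: mult_Suc mult_Suc_right)
qed

text \<open>Symmetry of the matrix tested on unit vectors: column \<open>m\<close> is also row
  \<open>m\<close>.\<close>

lemma ip_moment_op_unit_seq:
  assumes "v \<in> square_summable"
  shows "ip ell2 (moment_op (unit_seq m)) v = cnj (moment_op v m)"
  unfolding moment_op_unit_seq unfolding moment_op_def using assms by (intro ell2.ip_commute) auto

text \<open>Strong induction on the coefficient index. Once the coefficients below \<open>m\<close>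
  vanish, entry \<open>n\<close> is \<open>z n ^ Suc m * g (z n)\<close>, where \<open>g\<close> is
  a power series with constant term \<open>a m\<close>. Along \<open>r\<close> the decay forces
  \<open>g\<close> to tend to 0, while continuity makes it tend to \<open>a m\<close>.\<close>

lemma moment_op_eq_0_of_decay:
  assumes a: "a \<in> square_summable" and r: "filterlim r at_top sequentially"
    and decay: "\<And>k. cmod (moment_op a (r k)) \<le> M * (1/2) ^ (Suc (r k))\<^sup>2"
  shows "a = (\<lambda>_. 0)"
proof
  fix m
  show "a m = 0"
  proof (induction m rule: less_induct)
    case (less m)
    define g where "g = (\<lambda>w. \<Sum>j. a (j + m) * w ^ j)"
    have g: "(\<lambda>j. a (j + m) * w ^ j) sums g w" if "norm w < 1" for w
    proof -
      have "summable (\<lambda>j. a (j + m) * w ^ j)"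
      proof (rule summable_comparison_test'[where N = 0])
        show "summable (\<lambda>j. hnorm ell2 a * norm w ^ j)"
          using that by (intro summable_mult summable_geometric) auto
        show "norm (a (j + m) * w ^ j) \<le> hnorm ell2 a * norm w ^ j" for j
          unfolding norm_mult norm_power
          using norm_le_hnorm[OF a] by (intro mult_right_mono) auto
      qed
      then show ?thesis
        by (simp add: g_def summable_sums)
    qed
    define z :: "nat \<Rightarrow> complex" where "z = (\<lambda>n. (1/2) ^ Suc n)"
    have nz: "norm (z n) = (1/2) ^ Suc n" "norm (z n) < 1" for n
      using power_le_one[of "1/2 :: real" n]
      by (simp_all add: z_def norm_power norm_divide norm_mult)
    have K: "moment_op a n = z n ^ Suc m * g (z n)" for n
    proof -
      let ?f = "\<lambda>j. a j * cnj (moment_row n j)"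
      have "?f (j + m) = z n ^ Suc m * (a (j + m) * z n ^ j)" for j
      proof -
        have "cnj (moment_row n (j + m)) = z n ^ Suc (j + m)"
          unfolding moment_row_def z_def power_mult by simp
        also have "\<dots> = z n ^ Suc m * z n ^ j"
          by (simp add: power_add)
        finally show ?thesis by simp
      qed
      then have "(\<lambda>j. ?f (j + m)) sums (z n ^ Suc m * g (z n))"
        using sums_mult[OF g[OF nz(2)[of n]], of "z n ^ Suc m"] by (simp only:)
      then have "?f sums (z n ^ Suc m * g (z n))"
        using sums_zero_iff_shift[of m ?f] less by simp
      then show ?thesis
        by (simp add: moment_op_def ip_ell2 sums_unique[symmetric])
    qed
    have z0: "z \<longlonglongrightarrow> 0"
      unfolding z_def by (rule LIMSEQ_Suc[OF LIMSEQ_power_zero]) (simp add: norm_divide)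
    have zr: "(\<lambda>k. z (r k)) \<longlonglongrightarrow> 0"
      using filterlim_compose[OF z0 r] .
    have "(g \<longlongrightarrow> a (0 + m)) (at 0)"
      by (rule powser_limit_0[of 1 "\<lambda>j. a (j + m)"]) (use g in auto)
    \<comment> \<open>The limit of the power series is taken at 0 with 0 itself excluded; the powers
      of 1/2 are never 0.\<close>
    moreover have "filterlim (\<lambda>k. z (r k)) (at 0) sequentially"
      using zr by (simp add: filterlim_at z_def)
    ultimately have lim: "(\<lambda>k. g (z (r k))) \<longlonglongrightarrow> a m"
      using filterlim_compose by fastforce
    have "\<forall>\<^sub>F k in sequentially. norm (g (z (r k))) \<le> norm (z (r k)) * \<bar>M\<bar>"
    proof -
      \<comment> \<open>This makes the exponent \<open>Suc (r k)\<close> at least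
        \<open>m + 2\<close>: after cancelling \<open>t ^ Suc m\<close>, one factor \<open>t\<close>
        is left, and it tends to 0.\<close>
      have "\<forall>\<^sub>F k in sequentially. Suc m \<le> r k"
        using r by (simp add: filterlim_at_top)
      then show ?thesis
      proof eventually_elim
        case (elim k)
        define t where "t = norm (z (r k))"
        have t: "t > 0" "t < 1"
          using nz[of "r k"] by (auto simp: t_def z_def)
        \<comment> \<open>The square in the exponent makes the decay a power of \<open>t\<close>
          whose exponent grows with \<open>r k\<close>, hence eventually smaller than any fixed
          power.\<close>
        have e: "(1/2) ^ (Suc (r k))\<^sup>2 = t ^ Suc (r k)"
          unfolding t_def nz(1) power2_eq_square by (rule power_mult)
        have "t ^ Suc m * norm (g (z (r k))) = norm (moment_op a (r k))"
          by (simp add: K norm_mult norm_power t_def)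
        also have "\<dots> \<le> \<bar>M\<bar> * t ^ Suc (r k)"
          by (rule order_trans[OF decay[of k, unfolded e] mult_right_mono[OF abs_ge_self]])
             (use t in simp)
        also have "\<dots> \<le> \<bar>M\<bar> * t ^ (Suc m + 1)"
          using t elim by (intro mult_left_mono power_decreasing) auto
        finally have "t ^ Suc m * norm (g (z (r k))) \<le> t ^ Suc m * (t * \<bar>M\<bar>)"
          by (simp add: mult_ac)
        then have "norm (g (z (r k))) \<le> t * \<bar>M\<bar>"
          using mult_le_cancel_left_pos[OF zero_less_power[OF t(1)]] by blast
        then show ?case
          by (simp only: t_def)
      qed
    qed
    then have "(\<lambda>k. g (z (r k))) \<longlonglongrightarrow> 0"
      by (rule Lim_null_comparison[OF _ tendsto_mult_left_zero[OF tendsto_norm_zero[OF zr]]])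
    with lim show "a m = 0"
      using LIMSEQ_unique by blast
  qed
qed

text \<open>The zero sequence decays in the required sense along all indices, with constant
  0.\<close>

lemma moment_op_eq_0_imp:
  assumes "a \<in> square_summable" "moment_op a = (\<lambda>_. 0)"
  shows "a = (\<lambda>_. 0)"
  by (rule moment_op_eq_0_of_decay[where r = "\<lambda>k. k" and M = 0]) (use assms in \<open>auto simp: filterlim_ident\<close>)

lemma inj_on_moment_op: "inj_on moment_op square_summable"
proof (rule inj_onI)
  fix a b
  assume a: "a \<in> square_summable" and b: "b \<in> square_summable" and eq: "moment_op a = moment_op b"
  have "moment_op (\<lambda>n. a n + (- 1) * b n) = (\<lambda>n. moment_op a n + (- 1) * moment_op b n)"
    using moment_op_add[OF a square_summable_mult[OF b, of "- 1"]] moment_op_mult[OF b, of "- 1"]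
    by simp
  then have "(\<lambda>n. a n + (- 1) * b n) = (\<lambda>_. 0)"
    using a b eq by (intro moment_op_eq_0_imp[of "\<lambda>n. a n + (- 1) * b n"]) simp_all
  then show "a = b"
    by (simp add: fun_eq_iff)
qed

section \<open>The operator and its adjoint\<close>

definition sine :: "nat \<Rightarrow> real" where
  "sine n = (1/2) ^ (Suc n)\<^sup>2"

definition cosine :: "nat \<Rightarrow> real" where
  "cosine n = (- 1) ^ n * sqrt (1 - (sine n)\<^sup>2)"

definition reflect :: "(nat \<Rightarrow> complex) \<Rightarrow> nat \<Rightarrow> complex" where
  "reflect x = interleave (\<lambda>n. sine n * evens x n + cosine n * odds x n)
     (\<lambda>n. cosine n * evens x n - sine n * odds x n)"

lemma sine_pos: "0 < sine n" and sine_le_1: "sine n \<le> 1"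
  using power_le_one[of "1/2 :: real" "(Suc n)\<^sup>2"] by (simp_all add: sine_def)

lemma sine_cosine: "(sine n)\<^sup>2 + (cosine n)\<^sup>2 = 1"
  using sine_pos[of n] sine_le_1[of n] power_le_one[of "sine n" 2]
  by (simp add: cosine_def power_mult_distrib flip: power_mult)

text \<open>A number \<open>q\<close> in the unit interval satisfies
  \<open>q \<le> sqrt q \<le> 1\<close>. With \<open>q = 1 - (sine n)\<^sup>2\<close> the deviation
  is at most \<open>(sine n)\<^sup>2\<close>, hence at most \<open>sine n\<close>.\<close>

lemma cosine_near: "\<bar>cosine n - (- 1) ^ n\<bar> \<le> sine n"
proof -
  have s: "0 \<le> sine n" "(sine n)\<^sup>2 \<le> sine n"
    using sine_pos[of n] sine_le_1[of n] by (auto simp: power2_eq_square mult_left_le)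
  then have s1: "0 \<le> 1 - (sine n)\<^sup>2" "1 - (sine n)\<^sup>2 \<le> 1"
    using sine_le_1[of n] by auto
  have "1 - (sine n)\<^sup>2 \<le> sqrt (1 - (sine n)\<^sup>2)"
    using s1 by (intro real_le_rsqrt) (simp add: power2_eq_square mult_left_le)
  moreover have "sqrt (1 - (sine n)\<^sup>2) \<le> 1"
    using s1 by simp
  moreover have "cosine n - (- 1) ^ n = (- 1) ^ n * (sqrt (1 - (sine n)\<^sup>2) - 1)"
    by (simp add: cosine_def algebra_simps)
  ultimately show ?thesis
    using s by (simp add: abs_mult power_abs)
qed

lemma sine_cosine_complex:
  "complex_of_real (sine n) * sine n + complex_of_real (cosine n) * cosine n = 1"
  using arg_cong[OF sine_cosine[of n], of complex_of_real] by (simp add: power2_eq_square)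

text \<open>In each pair the mixed terms cancel and the diagonal factor is the sum of the squares of
  sine and cosine.\<close>

lemma reflect_reflect [simp]: "reflect (reflect x) = x"
proof -
  have "evens (reflect (reflect x)) n = evens x n" for n
  proof -
    have "evens (reflect (reflect x)) n =
      (complex_of_real (sine n) * sine n + complex_of_real (cosine n) * cosine n) * evens x n"
      by (simp add: reflect_def algebra_simps)
    then show ?thesis by (simp only: sine_cosine_complex mult_1)
  qed
  moreover have "odds (reflect (reflect x)) n = odds x n" for n
  proof -
    have "odds (reflect (reflect x)) n =
      (complex_of_real (sine n) * sine n + complex_of_real (cosine n) * cosine n) * odds x n"
      by (simp add: reflect_def algebra_simps)
    then show ?thesis by (simp only: sine_cosine_complex mult_1)
  qed
  ultimately show ?thesis
    by (metis ext interleave_evens_odds)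
qed

lemma reflect_add: "reflect (\<lambda>n. x n + y n) = (\<lambda>n. reflect x n + reflect y n)"
  unfolding reflect_def interleave_add
  by (simp add: evens_def odds_def algebra_simps)

lemma reflect_mult: "reflect (\<lambda>n. c * x n) = (\<lambda>n. c * reflect x n)"
  unfolding reflect_def interleave_mult
  by (simp add: evens_def odds_def algebra_simps)

lemma reflect_zero [simp]: "reflect (\<lambda>_. 0) = (\<lambda>_. 0)"
  by (simp add: reflect_def evens_def odds_def)

lemma square_summable_reflect [simp]:
  assumes "x \<in> square_summable" shows "reflect x \<in> square_summable"
proof -
  have "\<bar>cosine n\<bar> \<le> 1" for n
    unfolding abs_square_le_1[symmetric]
    using sine_cosine[of n] zero_le_power2[of "sine n"] by linarith
  then have c: "(\<lambda>n. cosine n * y n) \<in> square_summable" if "y \<in> square_summable" for y :: "nat \<Rightarrow> complex"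
    by (intro square_summable_dominated[OF that, where c = 1]) (auto simp: norm_mult mult_left_le_one_le)
  have s: "(\<lambda>n. sine n * y n) \<in> square_summable" if "y \<in> square_summable" for y :: "nat \<Rightarrow> complex"
    using sine_pos sine_le_1
    by (intro square_summable_dominated[OF that, where c = 1])
       (auto simp: norm_mult mult_left_le_one_le less_imp_le)
  show ?thesis
    unfolding reflect_def using assms
    by (intro square_summable_interleave square_summable_add square_summable_diff s c) auto
qed

text \<open>Each pair is multiplied by a real symmetric matrix of size 2, so the two series agree
  term by term.\<close>

lemma ip_reflect:
  assumes "x \<in> square_summable" "y \<in> square_summable"
  shows "ip ell2 (reflect x) y = ip ell2 x (reflect y)"
  unfolding ip_evens_odds[OF square_summable_reflect[OF assms(1)] assms(2)]
    ip_evens_odds[OF assms(1) square_summable_reflect[OF assms(2)]]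
  by (intro suminf_cong) (simp add: reflect_def algebra_simps)

text \<open>Both squares reduce to this. The alternating sign of \<open>cosine\<close> separates the
  unknowns: odd indices give decay for the image of \<open>a + b\<close>, even indices for that of
  \<open>a - b\<close>. Once both vanish, the positive factors \<open>sine n\<close> leave
  \<open>y = 0\<close>.\<close>

lemma moment_op_reflect_separated:
  assumes a: "a \<in> square_summable" and b: "b \<in> square_summable" and y: "y \<in> square_summable"
    and eq: "evens (reflect (interleave y (moment_op b))) = moment_op a"
  shows "a = (\<lambda>_. 0)" "b = (\<lambda>_. 0)" "y = (\<lambda>_. 0)"
proof -
  \<comment> \<open>The two norms bound the entries of \<open>y\<close> and of
    \<open>moment_op b\<close>, which \<open>near\<close> multiplies by \<open>sine n\<close> and by
    the deviation of \<open>cosine n\<close> from its sign.\<close>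
  define M where "M = hnorm ell2 y + hnorm ell2 (moment_op b)"
  have eq': "sine n * y n + cosine n * moment_op b n = moment_op a n" for n
    using fun_cong[OF eq, of n] by (simp add: reflect_def)
  have near: "cmod (moment_op a n - (- 1) ^ n * moment_op b n) \<le> M * sine n" for n
  proof -
    have "moment_op a n - (- 1) ^ n * moment_op b n =
        sine n * y n + complex_of_real (cosine n - (- 1) ^ n) * moment_op b n"
      unfolding eq'[symmetric] by (simp add: algebra_simps)
    also have "cmod \<dots> \<le> sine n * cmod (y n) + \<bar>cosine n - (- 1) ^ n\<bar> * cmod (moment_op b n)"
      using sine_pos[of n]
      by (intro order_trans[OF norm_triangle_ineq]) (simp add: norm_mult flip: of_real_diff)
    also have "\<dots> \<le> sine n * hnorm ell2 y + sine n * hnorm ell2 (moment_op b)"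
      using sine_pos[of n] y b
      by (intro add_mono mult_mono norm_le_hnorm cosine_near) auto
    finally show ?thesis
      by (simp add: M_def algebra_simps)
  qed
  have lin: "moment_op (\<lambda>n. a n + c * b n) n = moment_op a n + c * moment_op b n" for c n
    using a b by (simp add: moment_op_add moment_op_mult)
  have sum: "(\<lambda>n. a n + 1 * b n) = (\<lambda>_. 0)"
  proof (rule moment_op_eq_0_of_decay[where r = "\<lambda>k. Suc (2 * k)" and M = M])
    show "filterlim (\<lambda>k. Suc (2 * k)) at_top sequentially"
      by (intro filterlim_subseq strict_monoI) auto
    show "cmod (moment_op (\<lambda>n. a n + 1 * b n) (Suc (2 * k))) \<le> M * (1/2) ^ (Suc (Suc (2 * k)))\<^sup>2" for k
      using near[of "Suc (2 * k)"] unfolding lin sine_def by simp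
  qed (use a b in auto)
  have diff: "(\<lambda>n. a n + (- 1) * b n) = (\<lambda>_. 0)"
  proof (rule moment_op_eq_0_of_decay[where r = "\<lambda>k. 2 * k" and M = M])
    show "filterlim (\<lambda>k::nat. 2 * k) at_top sequentially"
      by (intro filterlim_subseq strict_monoI) auto
    show "cmod (moment_op (\<lambda>n. a n + (- 1) * b n) (2 * k)) \<le> M * (1/2) ^ (Suc (2 * k))\<^sup>2" for k
      using near[of "2 * k"] unfolding lin sine_def by simp
  qed (use a b square_summable_diff in auto)
  have "a n = 0 \<and> b n = 0" for n
    using fun_cong[OF sum, of n] fun_cong[OF diff, of n] by auto
  then show ab: "a = (\<lambda>_. 0)" "b = (\<lambda>_. 0)"
    by auto
  have "y n = 0" for n
    using eq'[of n] sine_pos[of n] by (simp add: ab)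
  then show "y = (\<lambda>_. 0)"
    by auto
qed

text \<open>The operator \<open>U (K\<inverse> \<oplus> K)\<close>, where the even and odd indices carry the two summands,
  \<open>U\<close> is \<^const>\<open>reflect\<close> and \<open>K\<close> is \<^const>\<open>moment_op\<close>.\<close>

definition reflected_op :: "(nat \<Rightarrow> complex) \<rightharpoonup> (nat \<Rightarrow> complex)" where
  "reflected_op x = (if x \<in> square_summable \<and> evens x \<in> moment_op ` square_summable
     then Some (reflect (interleave (inv_into square_summable moment_op (evens x)) (moment_op (odds x))))
     else None)"

text \<open>The graph is described without the inverse of \<open>moment_op\<close>: apply the
  involution \<open>reflect\<close> to the value and move the inverse to the other side of the
  equation, where injectivity makes it unambiguous. Addition, closedness and the square are read off
  from this form.\<close>

lemma reflected_op_eq_Some: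
  "reflected_op x = Some z \<longleftrightarrow> x \<in> square_summable \<and> z \<in> square_summable \<and>
     evens x = moment_op (evens (reflect z)) \<and> odds (reflect z) = moment_op (odds x)"
proof (intro iffI)
  assume T: "reflected_op x = Some z"
  let ?a = "inv_into square_summable moment_op (evens x)"
  have x: "x \<in> square_summable" "evens x \<in> moment_op ` square_summable"
    and z: "z = reflect (interleave ?a (moment_op (odds x)))"
    using T by (auto simp: reflected_op_def split: if_splits)
  have "?a \<in> square_summable" "moment_op ?a = evens x"
    using x(2) by (fact inv_into_into, fact f_inv_into_f)
  then show "x \<in> square_summable \<and> z \<in> square_summable \<and>
     evens x = moment_op (evens (reflect z)) \<and> odds (reflect z) = moment_op (odds x)"
    using x by (simp add: z)
next
  assume xz: "x \<in> square_summable \<and> z \<in> square_summable \<and>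
     evens x = moment_op (evens (reflect z)) \<and> odds (reflect z) = moment_op (odds x)"
  then have "inv_into square_summable moment_op (evens x) = evens (reflect z)"
    by (simp add: inv_into_f_f[OF inj_on_moment_op])
  moreover have "evens x \<in> moment_op ` square_summable"
    using xz by auto
  moreover have "reflect (interleave (evens (reflect z)) (moment_op (odds x))) = z"
    using xz by (metis interleave_evens_odds reflect_reflect)
  ultimately show "reflected_op x = Some z"
    using xz by (simp add: reflected_op_def)
qed

text \<open>Supplies the test vectors for density, unboundedness and the adjoint.\<close>

lemma reflected_op_interleave:
  assumes "a \<in> square_summable" "b \<in> square_summable"
  shows "reflected_op (interleave (moment_op a) b) = Some (reflect (interleave a (moment_op b)))"
  using assms by (simp add: reflected_op_eq_Some)

lemma reflected_op_add:
  assumes "reflected_op x = Some z" "reflected_op y = Some w"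
  shows "reflected_op (\<lambda>n. x n + y n) = Some (\<lambda>n. z n + w n)"
proof -
  have add: "evens (\<lambda>n. f n + g n) = (\<lambda>n. evens f n + evens g n)"
    "odds (\<lambda>n. f n + g n) = (\<lambda>n. odds f n + odds g n)" for f g
    by (auto simp: evens_def odds_def)
  show ?thesis
    using assms unfolding reflected_op_eq_Some by (simp add: add reflect_add moment_op_add)
qed

lemma reflected_op_mult:
  assumes "reflected_op x = Some z"
  shows "reflected_op (\<lambda>n. c * x n) = Some (\<lambda>n. c * z n)"
proof -
  have mult: "evens (\<lambda>n. c * f n) = (\<lambda>n. c * evens f n)"
    "odds (\<lambda>n. c * f n) = (\<lambda>n. c * odds f n)" for f
    by (auto simp: evens_def odds_def)
  show ?thesis
    using assms unfolding reflected_op_eq_Some by (simp add: mult reflect_mult moment_op_mult)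
qed

lemma reflected_op_zero: "reflected_op (\<lambda>_. 0) = Some (\<lambda>_. 0)"
  using reflected_op_interleave[of "\<lambda>_. 0" "\<lambda>_. 0"] by simp

section \<open>Linearity, density of the domain, unboundedness and closedness\<close>

lemma linear_operator_reflected_op: "linear_operator ell2 reflected_op"
  unfolding linear_operator_def
proof (intro conjI)
  show "submodule (dom reflected_op) complex_field ell2"
  proof (rule ell2.submoduleI)
    show "dom reflected_op \<subseteq> carrier ell2"
      by (auto simp: reflected_op_eq_Some)
    show "\<ominus>\<^bsub>ell2\<^esub> x \<in> dom reflected_op" if x: "x \<in> dom reflected_op" for x
      using x reflected_op_mult[of x _ "- 1"] ell2_uminus[of x]
      by (auto simp: reflected_op_eq_Some[of x] dom_def)
  qed (auto simp: reflected_op_zero reflected_op_add reflected_op_mult)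
  show "ran reflected_op \<subseteq> carrier ell2"
    by (auto simp: ran_def reflected_op_eq_Some)
qed (auto simp: reflected_op_add reflected_op_mult)

text \<open>A vector orthogonal to the domain is tested on unit vectors in the odd part, which kills
  its odd part, and on the images \<open>moment_op (unit_seq m)\<close> in the even part. By
  symmetry the latter say that \<open>moment_op\<close> annihilates its even part, which vanishes by
  injectivity.\<close>

lemma densely_defined_reflected_op: "densely_defined ell2 reflected_op"
  unfolding densely_defined_def
proof (rule ell2.dense_if_orthogonal_trivial)
  show "submodule (dom reflected_op) complex_field ell2"
    using linear_operator_reflected_op by (simp add: linear_operator_def)
  fix w
  assume "w \<in> carrier ell2" and orth: "\<And>x. x \<in> dom reflected_op \<Longrightarrow> ip ell2 x w = 0"
  then have w: "w \<in> square_summable"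
    by simp
  have orth': "ip ell2 (interleave (moment_op a) b) w = 0"
    if "a \<in> square_summable" "b \<in> square_summable" for a b
    using orth reflected_op_interleave[OF that] by blast
  have split: "ip ell2 w (interleave (moment_op a) b) = 0"
    if "a \<in> square_summable" "b \<in> square_summable" for a b
    using orth'[OF that] ell2.ip_commute[of w "interleave (moment_op a) b"] w that
    by (simp)
  have "odds w m = 0" for m
    using split[of "\<lambda>_. 0" "unit_seq m"] w
    by (simp add: ip_interleave_right ip_unit_seq)
  moreover have "moment_op (evens w) m = 0" for m
    using split[of "unit_seq m" "\<lambda>_. 0"] w
    by (simp add: ip_interleave_right moment_op_unit_seq moment_op_def[of "evens w"])
  then have "evens w = (\<lambda>_. 0)"
    using w by (intro moment_op_eq_0_imp[of "evens w"]) auto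
  ultimately show "w = \<zero>\<^bsub>ell2\<^esub>"
    using interleave_evens_odds[of w] by (metis ell2_sel(2) ext interleave_zero)
qed

text \<open>The vectors with even part \<open>moment_row m\<close> and odd part 0 have norm at most
  \<open>(1/2) ^ m\<close>, yet their images are reflected unit vectors of norm 1.\<close>

lemma unbounded_reflected_op: "\<not> bounded_operator ell2 reflected_op"
proof
  assume "bounded_operator ell2 reflected_op"
  then obtain C where C: "\<And>x. x \<in> dom reflected_op \<Longrightarrow>
      hnorm ell2 (the (reflected_op x)) \<le> C * hnorm ell2 x"
    by (auto simp: bounded_operator_def)
  have "1 \<le> \<bar>C\<bar> * (1/2) ^ m" for m
  proof -
    let ?e = "interleave (unit_seq m) (\<lambda>_. 0)"
    have norm: "hnorm ell2 (interleave a (\<lambda>_. 0)) = hnorm ell2 a" if "a \<in> square_summable" for a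
      unfolding hnorm_def using that by (simp add: ip_interleave_right)
    have "ip ell2 (reflect ?e) (reflect ?e) = ip ell2 ?e ?e"
      by (subst ip_reflect) simp_all
    then have "1 = hnorm ell2 (reflect ?e)"
      using norm[of "unit_seq m"]
      by (simp only: hnorm_def[of ell2 "reflect _"] hnorm_def[of ell2 ?e]
          square_summable_unit_seq hnorm_unit_seq)
    also have "\<dots> \<le> C * hnorm ell2 (interleave (moment_row m) (\<lambda>_. 0))"
      using C[of "interleave (moment_row m) (\<lambda>_. 0)"]
        reflected_op_interleave[of "unit_seq m" "\<lambda>_. 0"] by (auto simp: moment_op_unit_seq dom_def)
    also have "\<dots> = C * hnorm ell2 (moment_row m)"
      by (simp add: norm)
    also have "\<dots> \<le> \<bar>C\<bar> * (1/2) ^ m"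
      by (intro mult_mono hnorm_moment_row ell2.hnorm_nonneg) auto
    finally show ?thesis .
  qed
  moreover have "(\<lambda>m. \<bar>C\<bar> * (1/2) ^ m) \<longlonglongrightarrow> \<bar>C\<bar> * 0"
    by (intro tendsto_mult tendsto_const LIMSEQ_power_zero) simp
  ultimately have "1 \<le> \<bar>C\<bar> * 0"
    by (intro LIMSEQ_le_const) auto
  then show False by simp
qed

text \<open>Each coordinate of the two graph equations compares an inner product of \<open>x\<close>
  with one of \<open>z\<close> against fixed vectors, because \<open>reflect\<close> can be moved to
  the other argument.\<close>

lemma closed_operator_reflected_op: "closed_operator ell2 reflected_op"
proof -
  let ?z = "\<lambda>_::nat. 0::complex"
  define E where "E = (\<lambda>u v. {(x, z). x \<in> carrier ell2 \<and> z \<in> carrier ell2 \<and>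
    (\<forall>i\<in>(UNIV::nat set). ip ell2 x (u i) = ip ell2 z (v i))})"
  have closed: "closedin (prod_topology ell2.mtopology ell2.mtopology) (E u v)"
    if "\<And>i. u i \<in> square_summable" "\<And>i. v i \<in> square_summable" for u v
    unfolding E_def using that by (intro ell2.closedin_ip_eq) auto
  \<comment> \<open>The first family encodes \<open>evens x = moment_op (evens (reflect z))\<close>,
    the second \<open>moment_op (odds x) = odds (reflect z)\<close>.\<close>
  have graph: "Map.graph reflected_op =
    E (\<lambda>n. interleave (unit_seq n) ?z) (\<lambda>n. reflect (interleave (moment_row n) ?z)) \<inter>
    E (\<lambda>n. interleave ?z (moment_row n)) (\<lambda>n. reflect (interleave ?z (unit_seq n)))"
    (is "_ = ?R")
  proof -
    have "(x, z) \<in> ?R \<longleftrightarrow> reflected_op x = Some z" for x z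
    proof (cases "x \<in> square_summable \<and> z \<in> square_summable")
      case True
      then have x: "x \<in> square_summable" and z: "z \<in> square_summable"
        by auto
      have 1: "ip ell2 x (interleave (unit_seq n) ?z) = evens x n" for n
        using x by (simp add: ip_interleave_right ip_unit_seq)
      have 2: "ip ell2 z (reflect (interleave (moment_row n) ?z)) = moment_op (evens (reflect z)) n" for n
        using z by (simp add: ip_reflect[symmetric] ip_interleave_right moment_op_def)
      have 3: "ip ell2 x (interleave ?z (moment_row n)) = moment_op (odds x) n" for n
        using x by (simp add: ip_interleave_right moment_op_def)
      have 4: "ip ell2 z (reflect (interleave ?z (unit_seq n))) = odds (reflect z) n" for n
        using z by (simp add: ip_reflect[symmetric] ip_interleave_right ip_unit_seq)
      show ?thesis
        unfolding E_def reflected_op_eq_Some using x z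
        by (auto simp: 1 2 3 4 fun_eq_iff)
    qed (auto simp: E_def reflected_op_eq_Some)
    then show ?thesis
      by (auto simp: Map.graph_def)
  qed
  show ?thesis
    unfolding closed_operator_def graph by (intro closedin_Int closed) simp_all
qed

section \<open>The domains of the two squares\<close>

lemma reflected_op_square_domain: "dom (reflected_op \<circ>\<^sub>m reflected_op) = {\<lambda>_. 0}"
proof -
  have "x = (\<lambda>_. 0)" if T: "reflected_op x = Some z" "reflected_op z = Some w" for x z w
  proof -
    note xzw = T[unfolded reflected_op_eq_Some]
    have "reflect (interleave (evens (reflect z)) (moment_op (odds x))) = z"
      using xzw by (metis interleave_evens_odds reflect_reflect)
    \<comment> \<open>The first application presents \<open>z\<close> as a reflected pair, the
      second constrains its even part. This is the separated equation with \<open>y\<close>,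
      \<open>b\<close>, \<open>a\<close> taken as \<open>evens (reflect z)\<close>,
      \<open>odds x\<close>, \<open>evens (reflect w)\<close>.\<close>
    then have "evens (reflect (interleave (evens (reflect z)) (moment_op (odds x)))) =
        moment_op (evens (reflect w))"
      using xzw by simp
    from moment_op_reflect_separated[OF _ _ _ this] xzw
    have "evens (reflect z) = (\<lambda>_. 0)" "odds x = (\<lambda>_. 0)"
      by auto
    then have "evens x = (\<lambda>_. 0)"
      using xzw by simp
    with \<open>odds x = (\<lambda>_. 0)\<close> show ?thesis
      by (metis interleave_evens_odds interleave_zero)
  qed
  then show ?thesis
    unfolding dom_map_comp by (auto simp: reflected_op_zero dom_def)
qed

text \<open>After \<open>reflect\<close> is moved onto \<open>y\<close>, the adjoint relation is
  tested on a unit vector in one summand and 0 in the other. This places the adjoint inside the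
  composition with the factors in reverse order, an inclusion that suffices to bound the domain of
  its square.\<close>

lemma adjoint_reflected_op_image:
  assumes y: "y \<in> square_summable" and z: "z \<in> square_summable"
    and adj: "\<And>x. x \<in> dom reflected_op \<Longrightarrow> ip ell2 (the (reflected_op x)) y = ip ell2 x z"
  shows "evens (reflect y) = moment_op (evens z)" "odds z = moment_op (odds (reflect y))"
proof -
  have unit_left: "ip ell2 (unit_seq m) v = cnj (v m)" if "v \<in> square_summable" for m v
    using ell2.ip_commute[of "unit_seq m" v] that by (simp add: ip_unit_seq)
  have adj': "ip ell2 a (evens (reflect y)) + ip ell2 (moment_op b) (odds (reflect y)) =
      ip ell2 (moment_op a) (evens z) + ip ell2 b (odds z)"
    if a: "a \<in> square_summable" and b: "b \<in> square_summable" for a b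
  proof -
    have "ip ell2 (reflect (interleave a (moment_op b))) y = ip ell2 (interleave (moment_op a) b) z"
      using adj[of "interleave (moment_op a) b"] reflected_op_interleave[OF a b] by auto
    then show ?thesis
      using a b y z by (simp add: ip_reflect ip_interleave_left)
  qed
  show "evens (reflect y) = moment_op (evens z)"
  proof
    fix m
    show "evens (reflect y) m = moment_op (evens z) m"
      using adj'[of "unit_seq m" "\<lambda>_. 0"] y z
      by (simp add: unit_left ip_moment_op_unit_seq)
  qed
  show "odds z = moment_op (odds (reflect y))"
  proof
    fix m
    show "odds z m = moment_op (odds (reflect y)) m"
      using adj'[of "\<lambda>_. 0" "unit_seq m"] y z
      by (simp add: unit_left ip_moment_op_unit_seq)
  qed
qed

text \<open>The definite description in \<open>adjoint_op\<close> requires uniqueness. It comes from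
  the two equations: injectivity of \<open>moment_op\<close> fixes the even part of the image, and
  the odd part is given explicitly.\<close>

lemma adjoint_reflected_op_eq_Some:
  assumes "adjoint_op ell2 reflected_op y = Some z"
  shows "y \<in> square_summable" "z \<in> square_summable"
    "evens (reflect y) = moment_op (evens z)" "odds z = moment_op (odds (reflect y))"
proof -
  define Q where "Q = (\<lambda>z. z \<in> square_summable \<and>
    (\<forall>x\<in>dom reflected_op. ip ell2 (the (reflected_op x)) y = ip ell2 x z))"
  have y: "y \<in> square_summable" and ex: "\<exists>z. Q z" and z: "z = The Q"
    using assms by (auto simp: adjoint_op_def Let_def Q_def split: if_splits)
  have Q: "w \<in> square_summable" "evens (reflect y) = moment_op (evens w)"
    "odds w = moment_op (odds (reflect y))" if "Q w" for w
    using adjoint_reflected_op_image[OF y] that unfolding Q_def by blast+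
  have uniq: "w = w'" if "Q w" "Q w'" for w w'
  proof -
    have "evens w = evens w'"
      using inj_onD[OF inj_on_moment_op, of "evens w" "evens w'"] Q[OF that(1)] Q[OF that(2)] by simp
    then show ?thesis
      using Q(3)[OF that(1)] Q(3)[OF that(2)] by (metis interleave_evens_odds)
  qed
  obtain v where v: "Q v"
    using ex by blast
  then have "z = v"
    unfolding z by (intro the_equality uniq)
  with v have "Q z"
    by simp
  show "y \<in> square_summable" "z \<in> square_summable"
    "evens (reflect y) = moment_op (evens z)" "odds z = moment_op (odds (reflect y))"
    by (fact y Q[OF \<open>Q z\<close>])+
qed

text \<open>The zero vector is a witness for its own adjoint image, and the two equations force the
  chosen value to be zero. Hence 0 belongs to the domain of the square.\<close>

lemma adjoint_reflected_op_zero: "adjoint_op ell2 reflected_op (\<lambda>_. 0) = Some (\<lambda>_. 0)"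
proof -
  have "\<exists>z. z \<in> carrier ell2 \<and> (\<forall>x\<in>dom reflected_op.
      ip ell2 (the (reflected_op x)) (\<lambda>_. 0) = ip ell2 x z)"
    by (intro exI[of _ "\<lambda>_. 0"]) simp
  then have "\<exists>z. adjoint_op ell2 reflected_op (\<lambda>_. 0) = Some z"
    by (simp only: adjoint_op_def Let_def) simp
  then obtain z where z: "adjoint_op ell2 reflected_op (\<lambda>_. 0) = Some z"
    by blast
  have [simp]: "evens (\<lambda>_. 0) = (\<lambda>_. 0)" "odds (\<lambda>_. 0) = (\<lambda>_. 0)"
    by (auto simp: evens_def odds_def)
  note zz = adjoint_reflected_op_eq_Some[OF z]
  have "evens z = (\<lambda>_. 0)"
    using zz by (intro moment_op_eq_0_imp[of "evens z"]) auto
  then have "z = (\<lambda>_. 0)"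
    using zz(4) interleave_evens_odds[of z] by simp
  with z show ?thesis by simp
qed

lemma adjoint_reflected_op_square_domain:
  "dom (adjoint_op ell2 reflected_op \<circ>\<^sub>m adjoint_op ell2 reflected_op) = {\<lambda>_. 0}"
proof -
  have "y = (\<lambda>_. 0)"
    if T: "adjoint_op ell2 reflected_op y = Some z" "adjoint_op ell2 reflected_op z = Some w" for y z w
  proof -
    note yz = adjoint_reflected_op_eq_Some[OF T(1)] and zw = adjoint_reflected_op_eq_Some[OF T(2)]
    \<comment> \<open>Here \<open>z\<close> itself is the pair and the second application reflects
      it. The separated equation now has \<open>evens z\<close>, \<open>odds (reflect y)\<close> and
      \<open>evens w\<close> as \<open>y\<close>, \<open>b\<close> and \<open>a\<close>.\<close>
    have "evens (reflect (interleave (evens z) (moment_op (odds (reflect y))))) = moment_op (evens w)"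
      using yz(4) zw(3) by (metis interleave_evens_odds)
    from moment_op_reflect_separated[OF _ _ _ this] yz zw
    have zero: "evens z = (\<lambda>_. 0)" "odds (reflect y) = (\<lambda>_. 0)"
      by auto
    have "reflect y = interleave (evens (reflect y)) (odds (reflect y))"
      by (simp only: interleave_evens_odds)
    also have "\<dots> = (\<lambda>_. 0)"
      by (simp only: yz(3) zero moment_op_zero interleave_zero)
    finally have "reflect y = (\<lambda>_. 0)" .
    then show ?thesis
      by (metis reflect_reflect reflect_zero)
  qed
  then show ?thesis
    unfolding dom_map_comp by (auto simp: adjoint_reflected_op_zero dom_def)
qed

theorem theorem2p2:
  shows "\<exists>(H :: (nat \<Rightarrow> complex) inner_module) (T :: (nat \<Rightarrow> complex) \<rightharpoonup> (nat \<Rightarrow> complex)).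
    complex_hilbert_space H \<and> linear_operator H T \<and> densely_defined H T \<and>
    \<not> bounded_operator H T \<and> closed_operator H T \<and>
    dom (T \<circ>\<^sub>m T) = {\<zero>\<^bsub>H\<^esub>} \<and>
    dom (adjoint_op H T \<circ>\<^sub>m adjoint_op H T) = {\<zero>\<^bsub>H\<^esub>}"
  using ell2.complex_hilbert_space_axioms linear_operator_reflected_op densely_defined_reflected_op
    unbounded_reflected_op closed_operator_reflected_op reflected_op_square_domain
    adjoint_reflected_op_square_domain
  by (intro exI[of _ ell2] exI[of _ reflected_op]) simp

end
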